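(* Let $P$ be a poset and let $\eta:P\to\Gamma(P)$ be defined by $\eta(x)=\mathord{\downarrow}x$ for all $x\in P$. Then $\mathcal K(\Gamma(P))=cl_d(\eta(P))$; that is, $(\hat P,\eta)$ is the $D$-completion of $P$.
   Context: Posets carry the Scott topology ($U$ is open iff it is an upper set and every directed set whose supremum exists and lies in $U$ meets $U$); $\Gamma(P)$ is the complete lattice of Scott closed subsets of $P$ ordered by inclusion. A subset of a poset is $d$-closed if it contains the supremum (when it exists) of each of its directed subsets; $cl_d(B)$ is the smallest $d$-closed set containing $B$. Let $\mathcal H$ be the set of all $\mathcal D\subseteq\Gamma(P)\setminus\{\emptyset\}$ such that $\mathord{\downarrow}a\in\mathcal D$ whenever $A\in\mathcal D$ and $a\in A$, and $\mathcal D$ is $d$-closed in $\Gamma(P)$. For $A,B\in\Gamma(P)$ write $A\prec B$ if for every $\mathcal D\in\mathcal H$, $B\subseteq\sup\mathcal D$ implies $A\in\mathcal D$ (supremum in $\Gamma(P)$). $A$ is pre-$C$-compact if $A\prec A$, and $\mathcal K(\Gamma(P))$ is the set of pre-$C$-compact elements. $\hat P$ is $\mathcal K(\Gamma(P))$ with the relative topology of $\Gamma(P)$, where $\Gamma(P)$ has the lower Vietoris topology generated by the sets $\diamondsuit U=\{A:A\cap U\ne\emptyset\}$, $U$ Scott open. The specialization order of a $T_0$ space is $x\le y$ iff $x\in cl(\{y\})$. A monotone convergence space is a $T_0$ space in which the closure of every directed set (in the specialization order) is the closure of a unique point. A $D$-completion of a $T_0$ space $X$ is a monotone convergence space $Y$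 with a topological embedding $j:X\to Y$ such that $cl_d(j(X))=Y$ (in the specialization order of $Y$). *)

theory Defs
  imports "HOL-Analysis.Abstract_Topological_Spaces" "HOL-Algebra.Lattice"
begin

text \<open>Posets are the \<open>partial_order\<close> structures of HOL-Algebra, so that \<open>P\<close>, the lattice of its
  Scott closed sets and the specialization order of a space share one notion of directed set,
  supremum and \<open>d\<close>-closure. A supremum that need not exist is
  expressed by \<open>is_lub L s D\<close>.\<close>

text \<open>As usual, directed sets are nonempty.\<close>

definition directed :: "('a, 'b) gorder_scheme \<Rightarrow> 'a set \<Rightarrow> bool"
  where "directed L D \<longleftrightarrow> D \<subseteq> carrier L \<and> D \<noteq> {} \<and>
     (\<forall>x\<in>D. \<forall>y\<in>D. \<exists>z\<in>D. x \<sqsubseteq>\<^bsub>L\<^esub> z \<and> y \<sqsubseteq>\<^bsub>L\<^esub> z)"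

definition d_closed :: "('a, 'b) gorder_scheme \<Rightarrow> 'a set \<Rightarrow> bool"
  where "d_closed L C \<longleftrightarrow> C \<subseteq> carrier L \<and>
     (\<forall>D s. directed L D \<and> D \<subseteq> C \<and> is_lub L s D \<longrightarrow> s \<in> C)"

definition d_closure :: "('a, 'b) gorder_scheme \<Rightarrow> 'a set \<Rightarrow> 'a set"
  where "d_closure L B = d_closed L hull B"

definition down :: "('a, 'b) gorder_scheme \<Rightarrow> 'a \<Rightarrow> 'a set"
  where "down L a = {x \<in> carrier L. x \<sqsubseteq>\<^bsub>L\<^esub> a}"

definition scott_open :: "('a, 'b) gorder_scheme \<Rightarrow> 'a set \<Rightarrow> bool"
  where "scott_open P U \<longleftrightarrow> U \<subseteq> carrier P \<and>
     (\<forall>x\<in>U. \<forall>y\<in>carrier P. x \<sqsubseteq>\<^bsub>P\<^esub> y \<longrightarrow> y \<in> U) \<and>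
     (\<forall>D s. directed P D \<and> is_lub P s D \<and> s \<in> U \<longrightarrow> D \<inter> U \<noteq> {})"

lemma istopology_scott_open: "istopology (scott_open P)"
proof -
  have "scott_open P (S \<inter> T)" if S: "scott_open P S" and T: "scott_open P T" for S T
  proof -
    have "D \<inter> (S \<inter> T) \<noteq> {}"
      if D: "directed P D" "is_lub P s D" "s \<in> S \<inter> T" for D s
    proof -
      have "D \<inter> S \<noteq> {}" "D \<inter> T \<noteq> {}"
        using S T D unfolding scott_open_def by (metis IntD1, metis IntD2)
      then obtain x y where x: "x \<in> D" "x \<in> S" and y: "y \<in> D" "y \<in> T"
        by blast
      then obtain z where z: "z \<in> D" "x \<sqsubseteq>\<^bsub>P\<^esub> z" "y \<sqsubseteq>\<^bsub>P\<^esub> z" "z \<in> carrier P"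
        using D(1) by (meson directed_def subsetD)
      then have "z \<in> S" "z \<in> T"
        using S T x y by (simp_all add: scott_open_def)
      then show ?thesis
        using z by blast
    qed
    moreover have "S \<inter> T \<subseteq> carrier P"
      using S by (auto simp only: scott_open_def)
    moreover have "\<forall>x\<in>S \<inter> T. \<forall>y\<in>carrier P. x \<sqsubseteq>\<^bsub>P\<^esub> y \<longrightarrow> y \<in> S \<inter> T"
      using S T unfolding scott_open_def by (metis IntD1 IntD2 IntI)
    ultimately show ?thesis
      unfolding scott_open_def by meson
  qed
  moreover have "scott_open P (\<Union>\<U>)" if U: "\<forall>U\<in>\<U>. scott_open P U" for \<U>
  proof -
    have "D \<inter> \<Union>\<U> \<noteq> {}"
      if D: "directed P D" "is_lub P s D" "s \<in> \<Union>\<U>" for D s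
    proof -
      obtain U where "U \<in> \<U>" "s \<in> U"
        using D(3) by blast
      moreover then have "D \<inter> U \<noteq> {}"
        using U D unfolding scott_open_def by metis
      ultimately show ?thesis
        by blast
    qed
    moreover have "\<Union>\<U> \<subseteq> carrier P"
      using U by (simp add: scott_open_def Sup_le_iff)
    moreover have "\<forall>x\<in>\<Union>\<U>. \<forall>y\<in>carrier P. x \<sqsubseteq>\<^bsub>P\<^esub> y \<longrightarrow> y \<in> \<Union>\<U>"
    proof (intro ballI impI)
      fix x y assume "x \<in> \<Union>\<U>" "y \<in> carrier P" "x \<sqsubseteq>\<^bsub>P\<^esub> y"
      then obtain U where "U \<in> \<U>" "y \<in> U"
        using U by (meson UnionE scott_open_def)
      then show "y \<in> \<Union>\<U>"
        by blast
    qed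
    ultimately show ?thesis
      unfolding scott_open_def by meson
  qed
  ultimately show ?thesis
    by (simp add: istopology_def)
qed

definition scott :: "('a, 'b) gorder_scheme \<Rightarrow> 'a topology"
  where "scott P = topology (scott_open P)"

lemma openin_scott: "openin (scott P) U \<longleftrightarrow> scott_open P U"
  by (simp add: scott_def istopology_scott_open)

lemma topspace_scott [simp]: "topspace (scott P) = carrier P"
proof
  have "openin (scott P) (topspace (scott P))"
    by (rule openin_topspace)
  then show "topspace (scott P) \<subseteq> carrier P"
    unfolding openin_scott scott_open_def by (rule conjunct1)
  have "D \<inter> carrier P \<noteq> {}" if "directed P D" for D
    using that unfolding directed_def by fast
  then have "openin (scott P) (carrier P)"
    by (simp add: openin_scott scott_open_def)
  then show "carrier P \<subseteq> topspace (scott P)"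
    by (rule openin_subset)
qed

definition Gamma :: "('a, 'b) gorder_scheme \<Rightarrow> 'a set gorder"
  where "Gamma P = \<lparr>carrier = {A. closedin (scott P) A}, eq = (=), le = (\<subseteq>)\<rparr>"

lemma Gamma_sup_exists:
  assumes "\<D> \<subseteq> carrier (Gamma P)"
  shows "is_lub (Gamma P) (scott P closure_of \<Union>\<D>) \<D>"
proof -
  have "\<Union>\<D> \<subseteq> topspace (scott P)"
    using assms by (force simp: Gamma_def dest: closedin_subset)
  then have "\<Union>\<D> \<subseteq> scott P closure_of \<Union>\<D>"
    by (rule closure_of_subset)
  then have upper: "A \<subseteq> scott P closure_of \<Union>\<D>" if "A \<in> \<D>" for A
    using that by blast
  have minimal: "scott P closure_of \<Union>\<D> \<subseteq> B"
    if "closedin (scott P) B" "\<forall>A\<in>\<D>. A \<subseteq> B" for B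
    using that by (intro closure_of_minimal) auto
  show ?thesis
    unfolding least_def
  proof (intro conjI ballI)
    show "Upper (Gamma P) \<D> \<subseteq> carrier (Gamma P)"
      by (rule Upper_closed)
    show "scott P closure_of \<Union>\<D> \<in> Upper (Gamma P) \<D>"
      using upper by (simp add: Upper_def Gamma_def)
    show "scott P closure_of \<Union>\<D> \<sqsubseteq>\<^bsub>Gamma P\<^esub> B" if B: "B \<in> Upper (Gamma P) \<D>" for B
    proof -
      have "closedin (scott P) B" "\<forall>A\<in>\<D>. A \<subseteq> B"
        using B assms unfolding Upper_def Gamma_def by fastforce+
      then show ?thesis
        using minimal by (simp add: Gamma_def)
    qed
  qed
qed

definition \<H> :: "('a, 'b) gorder_scheme \<Rightarrow> 'a set set set"
  where "\<H> P = {\<D>. \<D> \<subseteq> carrier (Gamma P) - {{}} \<and>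
     (\<forall>A\<in>\<D>. \<forall>a\<in>A. down P a \<in> \<D>) \<and> d_closed (Gamma P) \<D>}"

definition C_below :: "('a, 'b) gorder_scheme \<Rightarrow> 'a set \<Rightarrow> 'a set \<Rightarrow> bool"
  where "C_below P A B \<longleftrightarrow> (\<forall>\<D>\<in>\<H> P. B \<subseteq> \<Squnion>\<^bsub>Gamma P\<^esub>\<D> \<longrightarrow> A \<in> \<D>)"

definition pre_C_compact :: "('a, 'b) gorder_scheme \<Rightarrow> 'a set \<Rightarrow> bool"
  where "pre_C_compact P A \<longleftrightarrow> A \<in> carrier (Gamma P) \<and> C_below P A A"

definition \<K> :: "('a, 'b) gorder_scheme \<Rightarrow> 'a set set"
  where "\<K> P = {A. pre_C_compact P A}"

definition diamond :: "('a, 'b) gorder_scheme \<Rightarrow> 'a set \<Rightarrow> 'a set set"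
  where "diamond P U = {A \<in> carrier (Gamma P). A \<inter> U \<noteq> {}}"

text \<open>The whole space is added to the subbase because \<^const>\<open>topology_generated_by\<close> does not
  count it as an empty intersection, and no \<open>diamond P U\<close> contains the empty set.\<close>

definition lower_vietoris :: "('a, 'b) gorder_scheme \<Rightarrow> 'a set topology"
  where "lower_vietoris P =
     topology_generated_by (insert (carrier (Gamma P)) {diamond P U |U. openin (scott P) U})"

definition P_hat :: "('a, 'b) gorder_scheme \<Rightarrow> 'a set topology"
  where "P_hat P = subtopology (lower_vietoris P) (\<K> P)"

definition specialization :: "'a topology \<Rightarrow> 'a gorder"
  where "specialization X =
     \<lparr>carrier = topspace X, eq = (=), le = (\<lambda>x y. x \<in> X closure_of {y})\<rparr>"

definition monotone_convergence_space :: "'a topology \<Rightarrow> bool"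
  where "monotone_convergence_space X \<longleftrightarrow> t0_space X \<and>
     (\<forall>D. directed (specialization X) D \<longrightarrow>
        (\<exists>!x. x \<in> topspace X \<and> X closure_of D = X closure_of {x}))"

definition D_completion :: "'a topology \<Rightarrow> 'b topology \<Rightarrow> ('a \<Rightarrow> 'b) \<Rightarrow> bool"
  where "D_completion X Y j \<longleftrightarrow> t0_space X \<and> monotone_convergence_space Y \<and>
     embedding_map X Y j \<and> d_closure (specialization Y) (j ` topspace X) = topspace Y"

end

theory Submission
  imports Defs
begin

text \<open>
  For a poset \<open>P\<close> the two descriptions of \<open>\<K> P\<close> meet in the set \<open>\<H> P\<close> of test families.

  On the one hand the \<open>d\<close>-closure \<open>\<C>\<close> of the principal ideals is itself a test family, and its
  supremum is the whole of \<open>P\<close>. A pre-\<open>C\<close>-compact set is therefore forced into \<open>\<C>\<close>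
  (\<open>\<K>_subset_d_closure_down\<close>).

  On the other hand the union of a test family \<open>\<D>\<close> is already Scott closed: it is a lower set, and a
  directed set \<open>E\<close> in it with supremum \<open>s\<close> lifts to the directed family of the ideals \<open>\<down>e\<close>,
  \<open>e \<in> E\<close>, which lies in \<open>\<D>\<close> and has supremum \<open>\<down>s\<close> in \<open>Gamma P\<close>
  (\<open>closedin_Union_\<H>\<close>). Hence \<open>sup \<D> = \<Union>\<D>\<close>, so a principal ideal below \<open>sup \<D>\<close> belongs to \<open>\<D>\<close>
  and is pre-\<open>C\<close>-compact. The pre-\<open>C\<close>-compact sets are moreover \<open>d\<close>-closed, because each \<open>\<D>\<close> is;
  so they contain \<open>\<C>\<close>.

  For the topological half the lower Vietoris topology has to be neither too coarse nor too fine.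
  It separates \<open>A\<close> from \<open>B\<close> whenever \<open>A\<close> is not a subset of \<open>B\<close>, by the open set
  \<open>diamond P (carrier P - B)\<close>; and every lower Vietoris open set is Scott open in \<open>Gamma P\<close> (\<open>scott_open_lower_vietoris\<close>). So the specialization order of \<open>P_hat P\<close> is
  inclusion, and a directed family converges to its supremum, which stays in \<open>\<K> P\<close> as \<open>\<K> P\<close> is
  \<open>d\<close>-closed. This makes \<open>P_hat P\<close> a monotone convergence space, and it transports
  \<open>d\<close>-closures computed in \<open>Gamma P\<close> to the specialization order. Finally the embedding property
  comes from the identity \<open>down P x \<inter> U \<noteq> {} \<longleftrightarrow> x \<in> U\<close> for Scott open \<open>U\<close>.
\<close>

section \<open>Closures under directed suprema\<close>

lemma is_lub_in_carrier: "is_lub L s D \<Longrightarrow> s \<in> carrier L"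
  by (auto simp: least_def Upper_def)

lemma d_closedI:
  assumes "C \<subseteq> carrier L"
    and "\<And>D s. directed L D \<Longrightarrow> D \<subseteq> C \<Longrightarrow> is_lub L s D \<Longrightarrow> s \<in> C"
  shows "d_closed L C"
  unfolding d_closed_def using assms(1) by (intro conjI allI impI) (auto intro: assms(2))

lemma d_closedD: "d_closed L C \<Longrightarrow> directed L D \<Longrightarrow> D \<subseteq> C \<Longrightarrow> is_lub L s D \<Longrightarrow> s \<in> C"
  unfolding d_closed_def by meson

lemma d_closed_carrier: "d_closed L (carrier L)"
  by (intro d_closedI order_refl is_lub_in_carrier)

lemma subset_d_closure: "B \<subseteq> d_closure L B"
  unfolding d_closure_def by (rule hull_subset)

lemma d_closure_minimal: "B \<subseteq> C \<Longrightarrow> d_closed L C \<Longrightarrow> d_closure L B \<subseteq> C"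
  unfolding d_closure_def by (rule hull_minimal)

lemma d_closed_d_closure:
  assumes "B \<subseteq> carrier L"
  shows "d_closed L (d_closure L B)"
proof (rule d_closedI)
  show "d_closure L B \<subseteq> carrier L"
    using assms d_closed_carrier by (rule d_closure_minimal)
  fix D s assume D: "directed L D" "D \<subseteq> d_closure L B" "is_lub L s D"
  have "s \<in> C" if C: "B \<subseteq> C" "d_closed L C" for C
  proof -
    have "D \<subseteq> C"
      using D(2) d_closure_minimal[OF C] by (rule order_trans)
    then show ?thesis
      using d_closedD[OF C(2) D(1)] D(3) by blast
  qed
  then show "s \<in> d_closure L B"
    by (auto simp: d_closure_def hull_def)
qed

section \<open>Scott closed sets and their lattice\<close>

lemma scott_open_upward:
  "scott_open P U \<Longrightarrow> x \<in> U \<Longrightarrow> y \<in> carrier P \<Longrightarrow> x \<sqsubseteq>\<^bsub>P\<^esub> y \<Longrightarrow> y \<in> U"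
  unfolding scott_open_def by meson

lemma scott_open_meets_directed:
  "scott_open P U \<Longrightarrow> directed P D \<Longrightarrow> is_lub P s D \<Longrightarrow> s \<in> U \<Longrightarrow> D \<inter> U \<noteq> {}"
  unfolding scott_open_def by meson

lemma scott_openI:
  assumes "U \<subseteq> carrier P"
    and "\<And>x y. x \<in> U \<Longrightarrow> y \<in> carrier P \<Longrightarrow> x \<sqsubseteq>\<^bsub>P\<^esub> y \<Longrightarrow> y \<in> U"
    and "\<And>D s. directed P D \<Longrightarrow> is_lub P s D \<Longrightarrow> s \<in> U \<Longrightarrow> D \<inter> U \<noteq> {}"
  shows "scott_open P U"
  unfolding scott_open_def using assms(1)
  by (intro conjI ballI allI impI) (auto intro: assms(2) dest: assms(3))

lemma closedin_scott_iff:
  "closedin (scott P) A \<longleftrightarrow>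
     (\<forall>y\<in>A. \<forall>x\<in>carrier P. x \<sqsubseteq>\<^bsub>P\<^esub> y \<longrightarrow> x \<in> A) \<and> d_closed P A" (is "?l \<longleftrightarrow> ?r")
proof
  assume ?l
  then have A: "A \<subseteq> carrier P" and U: "scott_open P (carrier P - A)"
    by (simp_all add: closedin_def openin_scott)
  have sup: "s \<in> A" if D: "directed P D" "D \<subseteq> A" "is_lub P s D" for D s
  proof (rule ccontr)
    assume "s \<notin> A"
    then have "D \<inter> (carrier P - A) \<noteq> {}"
      using scott_open_meets_directed[OF U D(1,3)] is_lub_in_carrier[OF D(3)] by simp
    then show False
      using D(2) by blast
  qed
  have "d_closed P A"
    by (intro d_closedI A sup)
  moreover have "x \<in> A" if "y \<in> A" "x \<in> carrier P" "x \<sqsubseteq>\<^bsub>P\<^esub> y" for x y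
    using scott_open_upward[OF U, of x y] that A by blast
  ultimately show ?r
    by simp
next
  assume r: ?r
  then have closed: "d_closed P A" and A: "A \<subseteq> carrier P"
    by (simp_all add: d_closed_def)
  have "D \<inter> (carrier P - A) \<noteq> {}"
    if D: "directed P D" "is_lub P s D" "s \<in> carrier P - A" for D s
  proof
    assume "D \<inter> (carrier P - A) = {}"
    then have "D \<subseteq> A"
      using D(1) by (auto simp: directed_def)
    then show False
      using d_closedD[OF closed D(1) _ D(2)] D(3) by simp
  qed
  then have "scott_open P (carrier P - A)"
    using r by (intro scott_openI) auto
  then show ?l
    using A by (simp add: closedin_def openin_scott)
qed

lemma closedin_scottI:
  assumes "A \<subseteq> carrier P"
    and "\<And>x y. y \<in> A \<Longrightarrow> x \<in> carrier P \<Longrightarrow> x \<sqsubseteq>\<^bsub>P\<^esub> y \<Longrightarrow> x \<in> A"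
    and "\<And>D s. directed P D \<Longrightarrow> D \<subseteq> A \<Longrightarrow> is_lub P s D \<Longrightarrow> s \<in> A"
  shows "closedin (scott P) A"
  unfolding closedin_scott_iff using assms(2) d_closedI[OF assms(1,3)] by simp

lemma carrier_Gamma: "carrier (Gamma P) = {A. closedin (scott P) A}"
  by (simp add: Gamma_def)

lemma le_Gamma: "A \<sqsubseteq>\<^bsub>Gamma P\<^esub> B \<longleftrightarrow> A \<subseteq> B"
  by (simp add: Gamma_def)

lemma Gamma_subset_carrier: "A \<in> carrier (Gamma P) \<Longrightarrow> A \<subseteq> carrier P"
  using closedin_subset[of "scott P" A] by (simp add: carrier_Gamma)

lemma Union_Gamma_subset_carrier:
  "\<D> \<subseteq> carrier (Gamma P) \<Longrightarrow> \<Union>\<D> \<subseteq> carrier P"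
  by (meson Gamma_subset_carrier Union_least subsetD)

lemma is_lub_Gamma_iff:
  assumes "\<D> \<subseteq> carrier (Gamma P)"
  shows "is_lub (Gamma P) S \<D> \<longleftrightarrow> S = scott P closure_of \<Union>\<D>"
proof
  assume S: "is_lub (Gamma P) S \<D>"
  show "S = scott P closure_of \<Union>\<D>"
  proof (rule subset_antisym)
    show "S \<subseteq> scott P closure_of \<Union>\<D>" "scott P closure_of \<Union>\<D> \<subseteq> S"
      using S Gamma_sup_exists[OF assms] by (simp_all add: least_def le_Gamma)
  qed
qed (simp add: Gamma_sup_exists[OF assms])

lemma sup_Gamma:
  assumes "\<D> \<subseteq> carrier (Gamma P)"
  shows "\<Squnion>\<^bsub>Gamma P\<^esub>\<D> = scott P closure_of \<Union>\<D>"
  unfolding sup_def by (simp add: is_lub_Gamma_iff[OF assms])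

lemma Union_subset_sup_Gamma:
  assumes "\<D> \<subseteq> carrier (Gamma P)"
  shows "\<Union>\<D> \<subseteq> \<Squnion>\<^bsub>Gamma P\<^esub>\<D>"
proof -
  have "\<Union>\<D> \<subseteq> topspace (scott P)"
    using Union_Gamma_subset_carrier[OF assms] by simp
  then show ?thesis
    by (simp add: sup_Gamma[OF assms] closure_of_subset)
qed

text \<open>Nonempty Scott closed sets form a \<open>d\<close>-closed family because directed families are nonempty,
  so that the supremum contains a nonempty member.\<close>

lemma d_closed_nonempty_closed_sets: "d_closed (Gamma P) (carrier (Gamma P) - {{}})"
proof (rule d_closedI)
  fix \<D> S
  assume \<D>: "directed (Gamma P) \<D>" "\<D> \<subseteq> carrier (Gamma P) - {{}}" "is_lub (Gamma P) S \<D>"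
  then obtain A where A: "A \<in> \<D>" "A \<noteq> {}" "A \<in> carrier (Gamma P)"
    unfolding directed_def by blast
  then have "A \<subseteq> S"
    using \<D>(3) by (auto simp: least_def Upper_def le_Gamma)
  then show "S \<in> carrier (Gamma P) - {{}}"
    using A(2) is_lub_in_carrier[OF \<D>(3)] by auto
qed blast

section \<open>Principal ideals\<close>

lemma mem_down_self: "partial_order P \<Longrightarrow> x \<in> carrier P \<Longrightarrow> x \<in> down P x"
  by (simp add: down_def partial_order_def weak_partial_order.le_refl)

lemma down_subset_iff:
  assumes "partial_order P" "x \<in> carrier P" "y \<in> carrier P"
  shows "down P x \<subseteq> down P y \<longleftrightarrow> x \<sqsubseteq>\<^bsub>P\<^esub> y"
proof -
  interpret partial_order P by fact
  show ?thesis
    using assms(2,3) le_trans by (auto simp: down_def)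
qed

lemma inj_on_down:
  assumes "partial_order P"
  shows "inj_on (down P) (carrier P)"
proof -
  interpret partial_order P by fact
  show ?thesis
    by (rule inj_onI) (metis assms down_subset_iff le_antisym order_refl)
qed

lemma closedin_scott_down:
  assumes "partial_order P" "x \<in> carrier P"
  shows "closedin (scott P) (down P x)"
proof -
  interpret partial_order P by fact
  have sup: "s \<in> down P x" if "D \<subseteq> down P x" "is_lub P s D" for D s
  proof -
    have "x \<in> Upper P D"
      using that(1) assms(2) by (auto simp: Upper_def down_def)
    then show ?thesis
      using that(2) is_lub_in_carrier[OF that(2)] by (simp add: least_def down_def)
  qed
  have lower: "z \<in> down P x" if "y \<in> down P x" "z \<in> carrier P" "z \<sqsubseteq>\<^bsub>P\<^esub> y" for y z
    using that assms(2) le_trans[of z y x] by (simp add: down_def)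
  have "down P x \<subseteq> carrier P"
    by (auto simp: down_def)
  then show ?thesis
    by (rule closedin_scottI) (rule lower, assumption+, rule sup, assumption+)
qed

lemma down_subset_closed:
  assumes "A \<in> carrier (Gamma P)" "a \<in> A"
  shows "down P a \<subseteq> A"
proof -
  have "closedin (scott P) A"
    using assms(1) by (simp add: carrier_Gamma)
  then have "\<forall>y\<in>A. \<forall>x\<in>carrier P. x \<sqsubseteq>\<^bsub>P\<^esub> y \<longrightarrow> x \<in> A"
    by (simp add: closedin_scott_iff)
  then show ?thesis
    using assms(2) unfolding down_def by blast
qed

lemma down_image_subset_Gamma:
  "partial_order P \<Longrightarrow> down P ` carrier P \<subseteq> carrier (Gamma P)"
  unfolding carrier_Gamma by (intro image_subsetI CollectI closedin_scott_down)

lemma directed_down_image: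
  assumes "partial_order P" "directed P E"
  shows "directed (Gamma P) (down P ` E)"
proof -
  have E: "E \<subseteq> carrier P" "E \<noteq> {}"
    using assms(2) by (simp_all add: directed_def)
  have down: "down P x \<subseteq> down P z" if "x \<in> E" "z \<in> E" "x \<sqsubseteq>\<^bsub>P\<^esub> z" for x z
    using that(3) by (simp add: down_subset_iff[OF assms(1)] that(1,2)[THEN subsetD[OF E(1)]])
  have "\<exists>z\<in>E. down P x \<subseteq> down P z \<and> down P y \<subseteq> down P z" if "x \<in> E" "y \<in> E" for x y
  proof -
    have "\<exists>z\<in>E. x \<sqsubseteq>\<^bsub>P\<^esub> z \<and> y \<sqsubseteq>\<^bsub>P\<^esub> z"
      using assms(2) that by (simp add: directed_def)
    then obtain z where z: "z \<in> E" "x \<sqsubseteq>\<^bsub>P\<^esub> z" "y \<sqsubseteq>\<^bsub>P\<^esub> z"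
      by blast
    show ?thesis
      by (rule bexI[OF _ z(1)]) (simp add: down that z)
  qed
  moreover have "down P ` E \<subseteq> carrier (Gamma P)"
    using image_mono[OF E(1)] down_image_subset_Gamma[OF assms(1)] by (rule order_trans)
  ultimately show ?thesis
    using E(2) by (simp add: directed_def le_Gamma)
qed

text \<open>The union of the ideals \<open>\<down>e\<close> may miss the supremum \<open>s\<close> of \<open>E\<close>, but its closure does not:
  a Scott closed set that contains \<open>E\<close> contains \<open>s\<close>, and then all of \<open>\<down>s\<close>.\<close>

lemma is_lub_down_image:
  assumes "partial_order P" "directed P E" "is_lub P s E"
  shows "is_lub (Gamma P) (down P s) (down P ` E)"
proof -
  have E: "E \<subseteq> carrier P"
    using assms(2) by (simp add: directed_def)
  have s: "s \<in> carrier P"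
    using assms(3) by (rule is_lub_in_carrier)
  have sub: "down P ` E \<subseteq> carrier (Gamma P)"
    using E down_image_subset_Gamma[OF assms(1)] by blast
  let ?C = "scott P closure_of \<Union>(down P ` E)"
  have C: "?C \<in> carrier (Gamma P)"
    by (simp add: carrier_Gamma)
  have "e \<sqsubseteq>\<^bsub>P\<^esub> s" if "e \<in> E" for e
    using assms(3) E that by (auto simp: least_def Upper_def)
  then have "\<Union>(down P ` E) \<subseteq> down P s"
    using E s down_subset_iff[OF assms(1)] by blast
  then have "?C \<subseteq> down P s"
    using closedin_scott_down[OF assms(1) s] by (rule closure_of_minimal)
  moreover have "down P s \<subseteq> ?C"
  proof (rule down_subset_closed[OF C])
    have "E \<subseteq> \<Union>(down P ` E)"
      using E mem_down_self[OF assms(1)] by blast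
    also have "\<dots> \<subseteq> ?C"
      using Union_subset_sup_Gamma[OF sub] by (simp add: sup_Gamma[OF sub])
    finally show "s \<in> ?C"
      using C assms(2,3) d_closedD[of P ?C E s] by (simp add: carrier_Gamma closedin_scott_iff)
  qed
  ultimately show ?thesis
    by (simp add: is_lub_Gamma_iff[OF sub] subset_antisym)
qed

section \<open>Pre-\<open>C\<close>-compact sets\<close>

lemma \<H>_subset: "\<D> \<in> \<H> P \<Longrightarrow> \<D> \<subseteq> carrier (Gamma P)"
  unfolding \<H>_def by blast

lemma \<H>_down: "\<D> \<in> \<H> P \<Longrightarrow> A \<in> \<D> \<Longrightarrow> a \<in> A \<Longrightarrow> down P a \<in> \<D>"
  unfolding \<H>_def by blast

lemma \<H>_d_closed: "\<D> \<in> \<H> P \<Longrightarrow> d_closed (Gamma P) \<D>"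
  unfolding \<H>_def by blast

lemma \<K>I:
  assumes "A \<in> carrier (Gamma P)"
    and "\<And>\<D>. \<D> \<in> \<H> P \<Longrightarrow> A \<subseteq> \<Squnion>\<^bsub>Gamma P\<^esub>\<D> \<Longrightarrow> A \<in> \<D>"
  shows "A \<in> \<K> P"
  using assms by (simp add: \<K>_def pre_C_compact_def C_below_def)

lemma \<K>D: "A \<in> \<K> P \<Longrightarrow> \<D> \<in> \<H> P \<Longrightarrow> A \<subseteq> \<Squnion>\<^bsub>Gamma P\<^esub>\<D> \<Longrightarrow> A \<in> \<D>"
  by (simp add: \<K>_def pre_C_compact_def C_below_def)

text \<open>A directed subset \<open>E\<close> of the union need not lie in any single member, so closedness of the
  members is of no help. Its elements do however yield principal ideals in \<open>\<D>\<close>, and these form a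
  directed family to which \<open>d\<close>-closedness of \<open>\<D>\<close> applies.\<close>

lemma closedin_Union_\<H>:
  assumes "partial_order P" "\<D> \<in> \<H> P"
  shows "closedin (scott P) (\<Union>\<D>)"
proof -
  have down: "down P a \<in> \<D>" if "a \<in> \<Union>\<D>" for a
    using that by (elim UnionE) (rule \<H>_down[OF assms(2)])
  have sup: "s \<in> \<Union>\<D>" if E: "directed P E" "E \<subseteq> \<Union>\<D>" "is_lub P s E" for E s
  proof -
    have "down P ` E \<subseteq> \<D>"
      using E(2) by (intro image_subsetI down) (rule subsetD)
    then have "down P s \<in> \<D>"
      using is_lub_down_image[OF assms(1) E(1,3)]
      by (rule d_closedD[OF \<H>_d_closed[OF assms(2)] directed_down_image[OF assms(1) E(1)]])
    then show ?thesis
      by (rule UnionI) (rule mem_down_self[OF assms(1) is_lub_in_carrier[OF E(3)]])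
  qed
  have lower: "x \<in> \<Union>\<D>" if "y \<in> \<Union>\<D>" "x \<in> carrier P" "x \<sqsubseteq>\<^bsub>P\<^esub> y" for x y
    by (rule UnionI[OF down[OF that(1)]]) (use that in \<open>simp add: down_def\<close>)
  have "\<Union>\<D> \<subseteq> carrier P"
    by (rule Union_Gamma_subset_carrier[OF \<H>_subset[OF assms(2)]])
  then show ?thesis
    by (rule closedin_scottI) (rule lower, assumption+, rule sup, assumption+)
qed

lemma sup_Gamma_\<H>:
  assumes "partial_order P" "\<D> \<in> \<H> P"
  shows "\<Squnion>\<^bsub>Gamma P\<^esub>\<D> = \<Union>\<D>"
  using closedin_Union_\<H>[OF assms] by (simp add: sup_Gamma \<H>_subset[OF assms(2)] closure_of_eq)

lemma down_in_\<K>: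
  assumes "partial_order P" "x \<in> carrier P"
  shows "down P x \<in> \<K> P"
proof (rule \<K>I)
  fix \<D> assume \<D>: "\<D> \<in> \<H> P" "down P x \<subseteq> \<Squnion>\<^bsub>Gamma P\<^esub>\<D>"
  have "x \<in> \<Union>\<D>"
    using subsetD[OF \<D>(2) mem_down_self[OF assms]] by (simp only: sup_Gamma_\<H>[OF assms(1) \<D>(1)])
  then obtain A where "A \<in> \<D>" "x \<in> A"
    by (rule UnionE)
  then show "down P x \<in> \<D>"
    by (rule \<H>_down[OF \<D>(1)])
qed (simp add: carrier_Gamma closedin_scott_down[OF assms])

lemma \<K>_subset_Gamma: "\<K> P \<subseteq> carrier (Gamma P)"
  by (auto simp: \<K>_def pre_C_compact_def)

text \<open>A test family whose supremum covers \<open>sup \<A>\<close> covers every member of \<open>\<A>\<close>, so it contains all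
  of \<open>\<A>\<close>, and being \<open>d\<close>-closed it contains \<open>sup \<A>\<close>.\<close>

lemma d_closed_\<K>: "d_closed (Gamma P) (\<K> P)"
proof (rule d_closedI[OF \<K>_subset_Gamma])
  fix \<A> S assume \<A>: "directed (Gamma P) \<A>" "\<A> \<subseteq> \<K> P" "is_lub (Gamma P) S \<A>"
  have "S \<in> \<D>" if \<D>: "\<D> \<in> \<H> P" "S \<subseteq> \<Squnion>\<^bsub>Gamma P\<^esub>\<D>" for \<D>
  proof -
    have "A \<in> \<D>" if A: "A \<in> \<A>" for A
    proof (rule \<K>D[OF _ \<D>(1)])
      show "A \<in> \<K> P"
        using \<A>(2) A by (rule subsetD)
      have "A \<subseteq> S"
        using \<A>(1,3) A by (auto simp: least_def Upper_def le_Gamma directed_def)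
      then show "A \<subseteq> \<Squnion>\<^bsub>Gamma P\<^esub>\<D>"
        using \<D>(2) by (rule order_trans)
    qed
    then show ?thesis
      using d_closedD[OF \<H>_d_closed[OF \<D>(1)] \<A>(1) _ \<A>(3)] by blast
  qed
  then show "S \<in> \<K> P"
    by (rule \<K>I[OF is_lub_in_carrier[OF \<A>(3)]])
qed

lemma d_closure_down_in_\<H>:
  assumes "partial_order P"
  shows "d_closure (Gamma P) (down P ` carrier P) \<in> \<H> P" (is "?C \<in> _")
proof -
  have "down P ` carrier P \<subseteq> carrier (Gamma P) - {{}}"
    using down_image_subset_Gamma[OF assms] mem_down_self[OF assms] by blast
  then have sub: "?C \<subseteq> carrier (Gamma P) - {{}}"
    using d_closed_nonempty_closed_sets by (rule d_closure_minimal)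
  have "down P a \<in> ?C" if "A \<in> ?C" "a \<in> A" for A a
  proof -
    have "a \<in> carrier P"
      using that sub Gamma_subset_carrier by blast
    then show ?thesis
      using subset_d_closure by fast
  qed
  then show ?thesis
    using sub d_closed_d_closure[OF down_image_subset_Gamma[OF assms]] by (simp add: \<H>_def)
qed

lemma \<K>_subset_d_closure_down:
  assumes "partial_order P"
  shows "\<K> P \<subseteq> d_closure (Gamma P) (down P ` carrier P)" (is "_ \<subseteq> ?C")
proof
  fix A assume A: "A \<in> \<K> P"
  have "A \<subseteq> carrier P"
    using A \<K>_subset_Gamma Gamma_subset_carrier by blast
  also have "\<dots> \<subseteq> \<Union>?C"
    using mem_down_self[OF assms] subset_d_closure[of "down P ` carrier P" "Gamma P"] by blast
  finally have "A \<subseteq> \<Squnion>\<^bsub>Gamma P\<^esub>?C"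
    by (simp add: sup_Gamma_\<H>[OF assms d_closure_down_in_\<H>[OF assms]])
  then show "A \<in> ?C"
    by (rule \<K>D[OF A d_closure_down_in_\<H>[OF assms]])
qed

lemma \<K>_eq_d_closure_down:
  assumes "partial_order P"
  shows "\<K> P = d_closure (Gamma P) (down P ` carrier P)"
proof
  show "d_closure (Gamma P) (down P ` carrier P) \<subseteq> \<K> P"
    by (rule d_closure_minimal[OF image_subsetI d_closed_\<K>]) (rule down_in_\<K>[OF assms])
qed (rule \<K>_subset_d_closure_down[OF assms])

section \<open>The lower Vietoris topology\<close>

lemma topspace_lower_vietoris: "topspace (lower_vietoris P) = carrier (Gamma P)"
  by (auto simp: lower_vietoris_def diamond_def)

lemma openin_lower_vietoris_diamond:
  "openin (scott P) U \<Longrightarrow> openin (lower_vietoris P) (diamond P U)"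
  by (auto simp: lower_vietoris_def intro: topology_generated_by_Basis)

text \<open>An open set meets the closure of a union only if it meets the union; this is what makes the
  condition of meeting \<open>U\<close> inaccessible by directed suprema.\<close>

lemma scott_open_diamond:
  assumes "openin (scott P) U"
  shows "scott_open (Gamma P) (diamond P U)"
proof -
  have "\<D> \<inter> diamond P U \<noteq> {}"
    if \<D>: "directed (Gamma P) \<D>" "is_lub (Gamma P) S \<D>" "S \<in> diamond P U" for \<D> S
  proof -
    have sub: "\<D> \<subseteq> carrier (Gamma P)"
      using \<D>(1) by (simp add: directed_def)
    have "U \<inter> scott P closure_of \<Union>\<D> \<noteq> {}"
      using \<D>(2,3) by (auto simp: is_lub_Gamma_iff[OF sub] diamond_def)
    then have "U \<inter> \<Union>\<D> \<noteq> {}"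
      using openin_Int_closure_of_eq_empty[OF assms] by blast
    then show ?thesis
      using sub by (auto simp: diamond_def)
  qed
  then show ?thesis
    by (intro scott_openI) (auto simp: diamond_def le_Gamma)
qed

lemma scott_open_lower_vietoris:
  assumes "openin (lower_vietoris P) W"
  shows "scott_open (Gamma P) W"
proof (rule generate_topology_on_coarsest[OF istopology_scott_open])
  show "generate_topology_on
      (insert (carrier (Gamma P)) {diamond P U |U. openin (scott P) U}) W"
    using assms unfolding lower_vietoris_def by (rule openin_topology_generated_by)
  have "scott_open (Gamma P) (carrier (Gamma P))"
    using openin_topspace[of "scott (Gamma P)"] by (simp add: openin_scott)
  then show "scott_open (Gamma P) \<W>"
    if "\<W> \<in> insert (carrier (Gamma P)) {diamond P U |U. openin (scott P) U}" for \<W>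
    using that scott_open_diamond by auto
qed

lemma in_closure_of_singleton_lower_vietoris:
  assumes "A \<in> carrier (Gamma P)" "B \<in> carrier (Gamma P)"
  shows "A \<in> lower_vietoris P closure_of {B} \<longleftrightarrow> A \<subseteq> B"
proof
  assume A: "A \<in> lower_vietoris P closure_of {B}"
  have "openin (scott P) (carrier P - B)"
    using assms(2) by (simp add: carrier_Gamma closedin_def)
  then have "openin (lower_vietoris P) (diamond P (carrier P - B))"
    by (rule openin_lower_vietoris_diamond)
  moreover have "B \<notin> diamond P (carrier P - B)"
    by (auto simp: diamond_def)
  ultimately have "A \<notin> diamond P (carrier P - B)"
    using A by (auto simp: in_closure_of)
  then show "A \<subseteq> B"
    using assms(1) Gamma_subset_carrier[OF assms(1)] by (auto simp: diamond_def)
next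
  assume "A \<subseteq> B"
  then have "B \<in> W" if "openin (lower_vietoris P) W" "A \<in> W" for W
    using scott_open_upward[OF scott_open_lower_vietoris[OF that(1)] that(2) assms(2)]
    by (simp add: le_Gamma)
  then show "A \<in> lower_vietoris P closure_of {B}"
    using assms(1) by (auto simp: in_closure_of topspace_lower_vietoris)
qed

section \<open>The space of pre-\<open>C\<close>-compact sets\<close>

lemma topspace_P_hat: "topspace (P_hat P) = \<K> P"
  using \<K>_subset_Gamma[of P] by (auto simp: P_hat_def topspace_lower_vietoris)

lemma in_closure_of_singleton_P_hat:
  assumes "B \<in> \<K> P"
  shows "A \<in> P_hat P closure_of {B} \<longleftrightarrow> A \<in> \<K> P \<and> A \<subseteq> B"
  using assms in_closure_of_singleton_lower_vietoris[of A P B] \<K>_subset_Gamma[of P]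
  by (auto simp: P_hat_def closure_of_subtopology)

lemma carrier_specialization_P_hat: "carrier (specialization (P_hat P)) = \<K> P"
  by (simp add: specialization_def topspace_P_hat)

lemma le_specialization_P_hat:
  assumes "B \<in> \<K> P"
  shows "A \<sqsubseteq>\<^bsub>specialization (P_hat P)\<^esub> B \<longleftrightarrow> A \<in> \<K> P \<and> A \<subseteq> B"
  using in_closure_of_singleton_P_hat[OF assms] by (simp add: specialization_def)

lemma directed_specialization_P_hat:
  "directed (specialization (P_hat P)) \<D> \<longleftrightarrow> directed (Gamma P) \<D> \<and> \<D> \<subseteq> \<K> P"
proof (cases "\<D> \<subseteq> \<K> P")
  case True
  have "A \<sqsubseteq>\<^bsub>specialization (P_hat P)\<^esub> B \<longleftrightarrow> A \<subseteq> B" if "A \<in> \<D>" "B \<in> \<D>" for A B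
    using le_specialization_P_hat[OF subsetD[OF True that(2)]] subsetD[OF True that(1)] by simp
  then have "(\<forall>A\<in>\<D>. \<forall>B\<in>\<D>. \<exists>C\<in>\<D>.
        A \<sqsubseteq>\<^bsub>specialization (P_hat P)\<^esub> C \<and> B \<sqsubseteq>\<^bsub>specialization (P_hat P)\<^esub> C) \<longleftrightarrow>
      (\<forall>A\<in>\<D>. \<forall>B\<in>\<D>. \<exists>C\<in>\<D>. A \<subseteq> C \<and> B \<subseteq> C)"
    by (intro ball_cong bex_cong refl) simp
  moreover have "\<D> \<subseteq> carrier (Gamma P)"
    using True \<K>_subset_Gamma by (rule order_trans)
  ultimately show ?thesis
    using True by (simp add: directed_def carrier_specialization_P_hat le_Gamma)
qed (simp add: directed_def carrier_specialization_P_hat)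

text \<open>A supremum in \<open>Gamma P\<close> is least among more upper bounds than are available in \<open>\<K> P\<close>, so it
  remains a supremum as soon as it lies in \<open>\<K> P\<close>.\<close>

lemma is_lub_specialization_P_hat:
  assumes "\<D> \<subseteq> \<K> P" "is_lub (Gamma P) S \<D>" "S \<in> \<K> P"
  shows "is_lub (specialization (P_hat P)) S \<D>"
proof -
  have sub: "\<D> \<subseteq> carrier (Gamma P)"
    using assms(1) \<K>_subset_Gamma by (rule order_trans)
  have upper: "(\<forall>A. A \<in> \<D> \<longrightarrow> A \<sqsubseteq>\<^bsub>specialization (P_hat P)\<^esub> B) \<longleftrightarrow> (\<forall>A. A \<in> \<D> \<longrightarrow> A \<subseteq> B)"
    if "B \<in> \<K> P" for B
    using le_specialization_P_hat[OF that] subsetD[OF assms(1)] by simp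
  have "Upper (specialization (P_hat P)) \<D> = Upper (Gamma P) \<D> \<inter> \<K> P"
  proof (rule Set.set_eqI)
    show "B \<in> Upper (specialization (P_hat P)) \<D> \<longleftrightarrow> B \<in> Upper (Gamma P) \<D> \<inter> \<K> P" for B
      using upper assms(1) sub subsetD[OF \<K>_subset_Gamma, of B P]
      by (cases "B \<in> \<K> P")
        (simp_all add: Upper_def carrier_specialization_P_hat le_Gamma Int_absorb2)
  qed
  then show ?thesis
    using assms(2,3)
    by (auto simp: least_def carrier_specialization_P_hat le_Gamma le_specialization_P_hat)
qed

lemma t0_space_P_hat: "t0_space (P_hat P)"
  unfolding t0_space_closure_of_sing topspace_P_hat
  using in_closure_of_singleton_P_hat by blast

text \<open>The supremum of a directed family lies in its closure because lower Vietoris open sets are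
  Scott open; that the family lies below its supremum gives the other inclusion.\<close>

lemma closure_of_directed_P_hat:
  assumes "directed (Gamma P) \<D>" "\<D> \<subseteq> \<K> P" "is_lub (Gamma P) S \<D>"
  shows "P_hat P closure_of \<D> = P_hat P closure_of {S}"
proof -
  have S: "S \<in> \<K> P"
    using d_closed_\<K> assms by (rule d_closedD)
  have "\<exists>D\<in>\<D>. D \<in> W" if W: "openin (P_hat P) W" "S \<in> W" for W
  proof -
    obtain V where V: "openin (lower_vietoris P) V" "W = V \<inter> \<K> P"
      using W(1) by (auto simp: P_hat_def openin_subtopology)
    then have "\<D> \<inter> V \<noteq> {}"
      using scott_open_meets_directed[OF scott_open_lower_vietoris[OF V(1)] assms(1,3)] W(2)
      by blast
    then show ?thesis
      using V(2) assms(2) by blast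
  qed
  then have "S \<in> P_hat P closure_of \<D>"
    using S by (auto simp: in_closure_of topspace_P_hat)
  then have "P_hat P closure_of {S} \<subseteq> P_hat P closure_of \<D>"
    by (simp add: closure_of_minimal)
  moreover have "D \<subseteq> S" if "D \<in> \<D>" for D
    using assms(1,3) that by (auto simp: least_def Upper_def le_Gamma directed_def)
  then have "\<D> \<subseteq> P_hat P closure_of {S}"
    using assms(2) by (auto simp: in_closure_of_singleton_P_hat[OF S])
  then have "P_hat P closure_of \<D> \<subseteq> P_hat P closure_of {S}"
    by (simp add: closure_of_minimal)
  ultimately show ?thesis
    by blast
qed

lemma monotone_convergence_space_P_hat: "monotone_convergence_space (P_hat P)"
  unfolding monotone_convergence_space_def
proof (intro conjI allI impI)
  fix \<D> assume "directed (specialization (P_hat P)) \<D>"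
  then have \<D>: "directed (Gamma P) \<D>" "\<D> \<subseteq> \<K> P"
    by (simp_all add: directed_specialization_P_hat)
  obtain S where S: "is_lub (Gamma P) S \<D>"
    using \<D>(2) \<K>_subset_Gamma Gamma_sup_exists by blast
  have "S \<in> \<K> P"
    using d_closed_\<K> \<D> S by (rule d_closedD)
  then show "\<exists>!x. x \<in> topspace (P_hat P) \<and> P_hat P closure_of \<D> = P_hat P closure_of {x}"
    using closure_of_directed_P_hat[OF \<D> S] t0_space_P_hat[of P]
    unfolding t0_space_closure_of_sing topspace_P_hat by metis
qed (rule t0_space_P_hat)

lemma t0_space_scott:
  assumes "partial_order P"
  shows "t0_space (scott P)"
  unfolding t0_space_def topspace_scott
proof (intro ballI impI)
  fix x y assume xy: "x \<in> carrier P" "y \<in> carrier P" "x \<noteq> y"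
  then have "down P x \<noteq> down P y"
    using inj_on_down[OF assms] by (auto dest: inj_onD)
  then have "\<not> (x \<in> down P y \<and> y \<in> down P x)"
    using xy down_subset_iff[OF assms] by (auto simp: down_def)
  moreover have "openin (scott P) (carrier P - down P z)" if "z \<in> carrier P" for z
    using closedin_scott_down[OF assms that] by (simp add: closedin_def)
  ultimately show "\<exists>U. openin (scott P) U \<and> (x \<notin> U \<longleftrightarrow> y \<in> U)"
    using xy mem_down_self[OF assms] by (metis DiffD2 DiffI)
qed

lemma down_in_diamond_iff:
  assumes "partial_order P" "openin (scott P) U" "x \<in> carrier P"
  shows "down P x \<in> diamond P U \<longleftrightarrow> x \<in> U"
proof
  assume "down P x \<in> diamond P U"
  then obtain y where "y \<in> U" "y \<sqsubseteq>\<^bsub>P\<^esub> x"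
    by (auto simp: diamond_def down_def)
  then show "x \<in> U"
    using assms(2,3) scott_open_upward by (fastforce simp: openin_scott)
next
  assume "x \<in> U"
  then show "down P x \<in> diamond P U"
    using closedin_scott_down[OF assms(1,3)] mem_down_self[OF assms(1,3)]
    by (auto simp: diamond_def carrier_Gamma)
qed

lemma embedding_map_down:
  assumes "partial_order P"
  shows "embedding_map (scott P) (P_hat P) (down P)"
  unfolding embedding_map_def
proof (rule bijective_open_imp_homeomorphic_map)
  let ?Y = "subtopology (P_hat P) (down P ` topspace (scott P))"
  have \<K>: "down P ` carrier P \<subseteq> \<K> P"
    using down_in_\<K>[OF assms] by blast
  have preimage: "down P -` diamond P U \<inter> carrier P = U" if "openin (scott P) U" for U
    using down_in_diamond_iff[OF assms that] openin_subset[OF that] by auto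
  have "continuous_map (scott P) (lower_vietoris P) (down P)"
    unfolding lower_vietoris_def
  proof (rule continuous_on_generated_topo)
    show "down P ` topspace (scott P)
        \<subseteq> \<Union>(insert (carrier (Gamma P)) {diamond P U |U. openin (scott P) U})"
      using down_image_subset_Gamma[OF assms] by auto
    have "down P -` carrier (Gamma P) \<inter> carrier P = topspace (scott P)"
      using down_image_subset_Gamma[OF assms] by auto
    then show "openin (scott P) (down P -` \<W> \<inter> topspace (scott P))"
      if "\<W> \<in> insert (carrier (Gamma P)) {diamond P U |U. openin (scott P) U}" for \<W>
      using that preimage openin_topspace[of "scott P"] by auto
  qed
  then show "continuous_map (scott P) ?Y (down P)"
    using \<K> unfolding P_hat_def by (auto intro!: continuous_map_into_subtopology)
  show "open_map (scott P) ?Y (down P)"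
    unfolding open_map_def
  proof (intro allI impI)
    fix U assume U: "openin (scott P) U"
    have "down P ` U = (diamond P U \<inter> \<K> P) \<inter> down P ` carrier P"
      using down_in_\<K>[OF assms] down_in_diamond_iff[OF assms U] openin_subset[OF U] by auto
    then show "openin ?Y (down P ` U)"
      using openin_lower_vietoris_diamond[OF U] by (auto simp: P_hat_def openin_subtopology)
  qed
  show "down P ` topspace (scott P) = topspace ?Y"
    using \<K> by (auto simp: topspace_P_hat)
  show "inj_on (down P) (topspace (scott P))"
    using inj_on_down[OF assms] by simp
qed

text \<open>Directed suprema in \<open>Gamma P\<close> of members of \<open>\<K> P\<close> stay in \<open>\<K> P\<close> and are suprema there. A subset
  of \<open>\<K> P\<close> that is \<open>d\<close>-closed for the specialization order is therefore \<open>d\<close>-closed in \<open>Gamma P\<close>,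
  and the \<open>d\<close>-closure in the smaller poset is no smaller than the one in \<open>Gamma P\<close>.\<close>

lemma d_closure_specialization_P_hat:
  assumes "partial_order P"
  shows "d_closure (specialization (P_hat P)) (down P ` carrier P) = \<K> P" (is "?C = _")
proof
  have \<K>: "down P ` carrier P \<subseteq> carrier (specialization (P_hat P))"
    using down_in_\<K>[OF assms] by (auto simp: carrier_specialization_P_hat)
  then have closed: "d_closed (specialization (P_hat P)) ?C"
    by (rule d_closed_d_closure)
  then show sub: "?C \<subseteq> \<K> P"
    by (simp add: d_closed_def carrier_specialization_P_hat)
  have "d_closed (Gamma P) ?C"
  proof (rule d_closedI)
    show "?C \<subseteq> carrier (Gamma P)"
      using sub \<K>_subset_Gamma by blast
    fix \<D> S assume \<D>: "directed (Gamma P) \<D>" "\<D> \<subseteq> ?C" "is_lub (Gamma P) S \<D>"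
    have sub\<D>: "\<D> \<subseteq> \<K> P"
      using \<D>(2) sub by (rule order_trans)
    have "S \<in> \<K> P"
      using d_closed_\<K> \<D>(1) sub\<D> \<D>(3) by (rule d_closedD)
    then have "is_lub (specialization (P_hat P)) S \<D>"
      by (rule is_lub_specialization_P_hat[OF sub\<D> \<D>(3)])
    moreover have "directed (specialization (P_hat P)) \<D>"
      using \<D>(1) sub\<D> by (simp add: directed_specialization_P_hat)
    ultimately show "S \<in> ?C"
      using \<D>(2) d_closedD[OF closed] by simp
  qed
  then show "\<K> P \<subseteq> ?C"
    unfolding \<K>_eq_d_closure_down[OF assms] by (rule d_closure_minimal[OF subset_d_closure])
qed

section \<open>The completion theorem\<close>

theorem theorem5p11:
  fixes P :: "('a, 'b) gorder_scheme" and \<eta> :: "'a \<Rightarrow> 'a set"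
  assumes "partial_order P"
    and "\<And>x. x \<in> carrier P \<Longrightarrow> \<eta> x = down P x"
  shows "\<K> P = d_closure (Gamma P) (\<eta> ` carrier P) \<and>
         D_completion (scott P) (P_hat P) \<eta>"
proof -
  have image: "\<eta> ` carrier P = down P ` carrier P"
    using assms(2) by (rule image_cong[OF refl])
  have "embedding_map (scott P) (P_hat P) \<eta>"
    using embedding_map_down[OF assms(1)] by (rule embedding_map_eq) (simp add: assms(2))
  then show ?thesis
    unfolding D_completion_def
    by (simp add: image topspace_P_hat \<K>_eq_d_closure_down[OF assms(1), symmetric]
        t0_space_scott[OF assms(1)] monotone_convergence_space_P_hat
        d_closure_specialization_P_hat[OF assms(1)])
qed

end
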